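(* For every $n\ge 3$ there exists a set $F$ of $n-2$ faulty edges or faulty vertices of $BP_n$ such that a paired 2-disjoint path cover of $BP_n-F$ joining certain terminal sets of size two does not exist.
   Context: For a positive integer $n$ write $\bar k=-k$, $[n]=\{1,\dots,n\}$ and $\langle n\rangle=[n]\cup\{\bar k\mid k\in[n]\}$. A signed permutation of $[n]$ is a sequence $u=u_1u_2\cdots u_n$ of elements of $\langle n\rangle$ such that $|u_1||u_2|\cdots|u_n|$ is a permutation of $[n]$. For $i\in[n]$, the $i$-th prefix reversal of $u$ is $u^i=\bar u_i\bar u_{i-1}\cdots\bar u_1u_{i+1}\cdots u_n$. The burnt pancake graph $BP_n$ is the graph whose vertices are all signed permutations of $[n]$, two vertices $u,v$ being adjacent iff $u^i=v$ for some $i\in[n]$. For a graph $G$ and a set $F\subseteq V(G)\cup E(G)$ of faulty elements (faulty vertices and faulty edges), $G-F$ is the graph with vertex set $V(G)\setminus F$ whose edges are the edges of $G$ that are not in $F$ and not incident with a vertex of $F$. A path between $a$ and $b$ is a sequence of distinct vertices starting at $a$ and ending at $b$, with consecutive vertices adjacent. Terminal sets of size two in a graph $G$ are two disjoint sets $S=\{s_1,s_2\}$ and $T=\{t_1,t_2\}$ of two distinct vertices of $G$ each. A paired 2-disjoint path cover (2-DPC) of $G$ joining $S$ and $T$ is a set of two vertex-disjoint paths in $G$, one between $s_1$ and $t_1$ and the other between $s_2$ and $t_2$, whose vertex sets together cover $V(G)$. *)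

theory Defs
  imports "HOL-Combinatorics.Multiset_Permutations"
begin

text \<open>
  Simple undirected graphs: an edge is a set of two vertices, so that an edge
  is a single element that can be faulty.
\<close>

record 'a ugraph =
  vertices :: "'a set"
  edges :: "'a set set"

text \<open>
  A set of faulty elements mixes vertices (\<open>Inl\<close>) and edges (\<open>Inr\<close>);
  it is a subset of \<open>vertices G <+> edges G\<close>.
\<close>

definition delete_faults :: "'a ugraph \<Rightarrow> ('a + 'a set) set \<Rightarrow> 'a ugraph" where
  "delete_faults G F =
     \<lparr>vertices = {v \<in> vertices G. Inl v \<notin> F},
      edges = {e \<in> edges G. Inr e \<notin> F \<and> (\<forall>v\<in>e. Inl v \<notin> F)}\<rparr>"

definition is_path :: "'a ugraph \<Rightarrow> 'a \<Rightarrow> 'a \<Rightarrow> 'a list \<Rightarrow> bool" where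
  "is_path G a b p \<longleftrightarrow>
     p \<noteq> [] \<and> hd p = a \<and> last p = b \<and> distinct p \<and> set p \<subseteq> vertices G \<and>
     successively (\<lambda>x y. {x, y} \<in> edges G) p"

text \<open>The terminal sets are \<open>S = {s1, s2}\<close> and \<open>T = {t1, t2}\<close>; the labelling matters for pairing.\<close>

definition terminal_sets :: "'a ugraph \<Rightarrow> 'a \<Rightarrow> 'a \<Rightarrow> 'a \<Rightarrow> 'a \<Rightarrow> bool" where
  "terminal_sets G s1 s2 t1 t2 \<longleftrightarrow>
     {s1, s2} \<subseteq> vertices G \<and> {t1, t2} \<subseteq> vertices G \<and>
     s1 \<noteq> s2 \<and> t1 \<noteq> t2 \<and> {s1, s2} \<inter> {t1, t2} = {}"

definition paired_2_dpc ::
    "'a ugraph \<Rightarrow> 'a \<Rightarrow> 'a \<Rightarrow> 'a \<Rightarrow> 'a \<Rightarrow> 'a list \<Rightarrow> 'a list \<Rightarrow> bool" where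
  "paired_2_dpc G s1 s2 t1 t2 p q \<longleftrightarrow>
     is_path G s1 t1 p \<and> is_path G s2 t2 q \<and>
     set p \<inter> set q = {} \<and> set p \<union> set q = vertices G"

text \<open>Signed permutations are written in one-line notation, with \<open>- k\<close> for the barred \<open>k\<close>.\<close>

definition signed_range :: "nat \<Rightarrow> int set" where
  "signed_range n = {1..int n} \<union> uminus ` {1..int n}"

definition signed_perms :: "nat \<Rightarrow> int list set" where
  "signed_perms n =
     {u. set u \<subseteq> signed_range n \<and> map abs u \<in> permutations_of_set {1..int n}}"

definition prefix_reversal :: "nat \<Rightarrow> int list \<Rightarrow> int list" where
  "prefix_reversal i u = rev (map uminus (take i u)) @ drop i u"

definition burnt_pancake :: "nat \<Rightarrow> int list ugraph" where
  "burnt_pancake n =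
     \<lparr>vertices = signed_perms n,
      edges = {{u, v} | u v. u \<in> signed_perms n \<and> v \<in> signed_perms n \<and>
                             (\<exists>i\<in>{1..n}. prefix_reversal i u = v)}\<rparr>"

end

(* Delete all but two of the n edges at a vertex v, and let the two surviving neighbours
   of v be s1 and s2. A path passing through v has to use both of them, but they lie on
   different paths of the cover. *)
theory Submission
  imports Defs
begin

text \<open>The predecessor and the successor of \<open>v\<close> on the path serve as
  \<open>x\<close> and \<open>y\<close>; they differ because a path repeats no vertex.\<close>

lemma is_path_inner_neighbours:
  assumes "is_path G a b p" "v \<in> set p" "v \<noteq> a" "v \<noteq> b"
  obtains x y where "x \<in> set p" "y \<in> set p" "x \<noteq> y" "{v, x} \<in> edges G" "{v, y} \<in> edges G"
proof -
  obtain xs ys where p: "p = xs @ v # ys"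
    using assms(2) by (auto dest: split_list)
  have ne: "xs \<noteq> []" "ys \<noteq> []"
    using assms p by (auto simp: is_path_def)
  have nb: "{last xs, v} \<in> edges G" "{v, hd ys} \<in> edges G"
    using assms(1) ne unfolding p is_path_def
    by (auto simp: successively_append_iff successively_Cons)
  moreover have inner: "last xs \<in> set xs" "hd ys \<in> set ys"
    using ne by auto
  moreover have "set xs \<inter> set ys = {}"
    using assms(1) by (auto simp: p is_path_def)
  ultimately have "last xs \<noteq> hd ys"
    by auto
  with nb inner show thesis
    using that[of "last xs" "hd ys"] by (simp add: p insert_commute)
qed

text \<open>Since \<open>v\<close> is not a terminal, it is an inner vertex of whichever path covers
  it. That path then contains two neighbours of \<open>v\<close>, hence both sources.\<close>

lemma no_paired_2_dpc_if_neighbours_are_sources: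
  assumes "v \<in> vertices G" "v \<notin> {s1, s2, t1, t2}"
    and nb: "\<And>x. {v, x} \<in> edges G \<Longrightarrow> x \<in> {s1, s2}"
  shows "\<not> paired_2_dpc G s1 s2 t1 t2 p q"
proof
  assume dpc: "paired_2_dpc G s1 s2 t1 t2 p q"
  have paths: "is_path G s1 t1 p" "is_path G s2 t2 q"
    and disj: "set p \<inter> set q = {}" and "v \<in> set p \<union> set q"
    using dpc assms(1) by (auto simp: paired_2_dpc_def)
  then obtain r x y where "r \<in> {p, q}" "x \<in> set r" "y \<in> set r" "x \<noteq> y"
    "{v, x} \<in> edges G" "{v, y} \<in> edges G"
    using assms(2) by (auto elim!: is_path_inner_neighbours)
  \<comment> \<open>Two distinct elements of \<open>{s1, s2}\<close> exhaust it.\<close>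
  then have "s1 \<in> set r" "s2 \<in> set r"
    using nb[of x] nb[of y] by auto
  moreover have "s1 \<in> set p" "s2 \<in> set q"
    using paths hd_in_set by (fastforce simp: is_path_def)+
  ultimately show False
    using disj \<open>r \<in> {p, q}\<close> by auto
qed

lemma prefix_reversal_involution:
  "i \<le> length u \<Longrightarrow> prefix_reversal i (prefix_reversal i u) = u"
  by (simp add: prefix_reversal_def rev_map comp_def)

text \<open>First entries suffice to tell apart all the vertices singled out in the main proof. The
  shift to \<open>i - 1\<close> comes from list indices starting at 0.\<close>

lemma hd_prefix_reversal:
  assumes "1 \<le> i" "i \<le> length u"
  shows "hd (prefix_reversal i u) = - u ! (i - 1)"
proof -
  obtain j where j: "i = Suc j" "j < length u"
    using assms by (cases i) auto
  then show ?thesis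
    by (simp add: prefix_reversal_def take_Suc_conv_app_nth)
qed

lemma length_signed_perms: "u \<in> signed_perms n \<Longrightarrow> length u = n"
  using length_finite_permutations_of_set[of "map abs u" "{1..int n}"]
  by (simp add: signed_perms_def)

lemma prefix_reversal_in_signed_perms:
  assumes "u \<in> signed_perms n"
  shows "prefix_reversal i u \<in> signed_perms n"
proof -
  \<comment> \<open>Absolute values absorb the sign changes, so only a rearrangement remains; the
    multiset determines both the set of entries and their distinctness.\<close>
  have "map abs (prefix_reversal i u) = rev (take i (map abs u)) @ drop i (map abs u)"
    by (simp add: prefix_reversal_def rev_map take_map drop_map)
  then have mset: "mset (map abs (prefix_reversal i u)) = mset (map abs u)"
    by (metis append_take_drop_id mset_append mset_rev)
  have "set (prefix_reversal i u) \<subseteq> set u \<union> uminus ` set u"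
    by (auto simp: prefix_reversal_def dest: in_set_takeD in_set_dropD)
  also have "\<dots> \<subseteq> signed_range n"
    using assms by (fastforce simp: signed_perms_def signed_range_def)
  finally show ?thesis
    using assms mset_eq_setD[OF mset] mset_eq_imp_distinct_iff[OF mset]
    by (simp add: signed_perms_def permutations_of_set_def)
qed

lemma prefix_reversal_edge:
  assumes "u \<in> signed_perms n" "i \<in> {1..n}"
  shows "{u, prefix_reversal i u} \<in> edges (burnt_pancake n)"
proof -
  have "\<exists>j\<in>{1..n}. prefix_reversal j u = prefix_reversal i u"
    using assms(2) by (rule bexI[rotated]) (rule refl)
  with assms(1) prefix_reversal_in_signed_perms[OF assms(1)] show ?thesis
    unfolding burnt_pancake_def ugraph.simps mem_Collect_eq 
    by (intro exI[of _ u] exI[of _ "prefix_reversal i u"] conjI refl)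
qed

text \<open>An unordered edge does not tell which end was reversed to give the other. As each
  reversal is an involution, the same \<open>i\<close> works from either end.\<close>

lemma burnt_pancake_neighbour:
  assumes "{v, x} \<in> edges (burnt_pancake n)"
  obtains i where "i \<in> {1..n}" "x = prefix_reversal i v"
proof -
  from assms obtain u i where "u \<in> signed_perms n" "i \<in> {1..n}"
    and e: "{v, x} = {u, prefix_reversal i u}"
    by (auto simp: burnt_pancake_def)
  moreover have "prefix_reversal i (prefix_reversal i u) = u"
    using calculation by (intro prefix_reversal_involution) (simp add: length_signed_perms)
  ultimately show thesis
    using that[of i] by (auto simp: doubleton_eq_iff)
qed

theorem mainTheorem2:
  fixes n :: nat
  assumes "n \<ge> 3"
  shows "\<exists>F. F \<subseteq> vertices (burnt_pancake n) <+> edges (burnt_pancake n) \<and> card F = n - 2 \<and>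
           (\<exists>s1 s2 t1 t2. terminal_sets (delete_faults (burnt_pancake n) F) s1 s2 t1 t2 \<and>
              \<not> (\<exists>p q. paired_2_dpc (delete_faults (burnt_pancake n) F) s1 s2 t1 t2 p q))"
proof -
  \<comment> \<open>With the identity as centre, \<open>r i\<close> begins with
    \<open>- int i\<close>, so its neighbours are recognised by their first entries.\<close>
  define v where "v = [1..int n]"
  define r where "r i = prefix_reversal i v" for i
  \<comment> \<open>The reversals of lengths 3 to \<open>n\<close> give exactly \<open>n - 2\<close>
    edges at \<open>v\<close>; those to \<open>r 1\<close> and \<open>r 2\<close> survive.\<close>
  define F :: "(int list + int list set) set" where "F = (\<lambda>i. Inr {v, r i}) ` {3..n}"
  define G where "G = delete_faults (burnt_pancake n) F"
  \<comment> \<open>For \<open>n = 3\<close> the vertex \<open>v\<close> has only the neighbours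
    \<open>r 1\<close>, \<open>r 2\<close>, \<open>r 3\<close>, so the fourth terminal is sought at
    distance two. It begins with 2, unlike \<open>v\<close> and every \<open>r i\<close>.\<close>
  define w where "w = prefix_reversal 1 (r 2)"
  have v: "v \<in> signed_perms n"
    by (auto simp: v_def signed_perms_def signed_range_def permutations_of_set_def distinct_map
        intro!: inj_onI)
  have r: "r i \<in> signed_perms n" for i
    using v by (simp add: r_def prefix_reversal_in_signed_perms)
  have hd_v: "hd v = 1"
    using assms by (simp add: v_def upto_rec1)
  have hd_r: "hd (r i) = - int i" if "i \<in> {1..n}" for i
    using that by (simp add: r_def hd_prefix_reversal v_def)
  have w: "w \<in> signed_perms n"
    using r by (simp add: w_def prefix_reversal_in_signed_perms)
  have len: "length (r 2) = n"
    by (rule length_signed_perms[OF r])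
  then have "r 2 ! 0 = hd (r 2)"
    using assms by (intro hd_conv_nth[symmetric]) auto
  then have hd_w: "hd w = 2"
    using assms hd_r[of 2] len by (simp add: w_def hd_prefix_reversal)
  \<comment> \<open>Different reversal lengths must give different faulty edges for the count to be
    right.\<close>
  have "inj_on (\<lambda>i. Inr {v, r i} :: int list + int list set) {3..n}"
  proof (rule inj_onI)
    fix i j assume ij: "i \<in> {3..n}" "j \<in> {3..n}" and eq: "Inr {v, r i} = Inr {v, r j}"
    from eq have "r i = r j"
      by (metis doubleton_eq_iff sum.inject(2))
    then have "hd (r i) = hd (r j)"
      by (rule arg_cong)
    with ij show "i = j"
      by (simp add: hd_r)
  qed
  then have card: "card F = n - 2"
    unfolding F_def using assms by (simp add: card_image)
  have "{v, r i} \<in> edges (burnt_pancake n)" if "i \<in> {1..n}" for i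
    unfolding r_def using v that by (rule prefix_reversal_edge)
  then have sub: "F \<subseteq> vertices (burnt_pancake n) <+> edges (burnt_pancake n)"
    by (auto simp: F_def)
  \<comment> \<open>All faults are edges, so no vertex is lost.\<close>
  have verts: "vertices G = signed_perms n"
    by (auto simp: G_def delete_faults_def burnt_pancake_def F_def)
  \<comment> \<open>Here \<open>n \<ge> 3\<close> guarantees that \<open>r 3\<close> exists. The
    first entries -1, -2, -3 and 2 separate the four terminals, and 1 separates \<open>v\<close>
    from them.\<close>
  have hds: "hd (r 1) = -1" "hd (r 2) = -2" "hd (r 3) = -3"
    using assms hd_r by simp_all
  have terms: "terminal_sets G (r 1) (r 2) (r 3) w"
    using verts r w hds hd_w by (auto simp: terminal_sets_def)
  have nb: "x \<in> {r 1, r 2}" if "{v, x} \<in> edges G" for x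
  proof -
    from that have "{v, x} \<in> edges (burnt_pancake n)" and nF: "Inr {v, x} \<notin> F"
      by (auto simp: G_def delete_faults_def)
    then obtain i where i: "i \<in> {1..n}" "x = r i"
      by (auto simp: r_def elim: burnt_pancake_neighbour)
    with nF have "i \<notin> {3..n}"
      by (auto simp: F_def)
    with i have "i = 1 \<or> i = 2"
      by auto
    with i show ?thesis
      by auto
  qed
  have "v \<notin> {r 1, r 2, r 3, w}"
    using hds hd_w hd_v by auto
  then have "\<not> paired_2_dpc G (r 1) (r 2) (r 3) w p q" for p q
    using v verts nb by (intro no_paired_2_dpc_if_neighbours_are_sources[where v = v]) auto
  then show ?thesis
    using sub card terms unfolding G_def by blast
qed

end
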